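(* Let $N\ge 2$ be even, let $V$ be an $N$-dimensional real vector space with a Lorentz-signature inner product $\eta_{ab}$, and let $K_{ab}=-K_{ba}$ be a bivector on $V$. Then the bivector alignment equations for $K_{ab}$ admit a real zero in the real extended space of null directions; that is, there exists a non-zero null vector $k\in V$ whose null direction $[k]$ is aligned with $K_{ab}$.
   Context: Lorentz signature means signature $(N-1,1)$, with $\eta(u,u)<0$ for time-like and $\eta(u,u)>0$ for space-like $u$. A null frame is a basis $\ell=m_0$, $n=m_1$, $m_2,\dots,m_{N-1}$ of $V$ with $\eta(\ell,n)=1$, $\eta(m_i,m_i)=1$ for $i=2,\dots,N-1$, and all other products zero. Components with respect to a null frame are $K_{AB}=K(m_A,m_B)$. A null vector is a vector $k$ with $\eta(k,k)=0$; a null direction $[k]$ is the span of a non-zero null vector. A null direction $[k]$ is aligned with $K$ if $K_{0i}=0$ for all $2\le i\le N-1$ in a null frame with $\ell$ a scalar multiple of $k$ (this is independent of the choice of such a frame). Fixing a null frame, the bivector alignment equations are $p_{0j}(z)=0$, $j=2,\dots,N-1$, where (space-like indices raised and lowered trivially, repeated indices summed over $2,\dots,N-1$) $$p_{0j}(z)=K_{0j}+z^iK_{ij}-z_jK_{01}-\tfrac12 z^iz_i\,K_{1j}-z^iz_j\,K_{i1}.$$ A point $z\in\mathbb{R}^{N-2}$ corresponds to the null direction spanned by $\ell+z^im_i-\tfrac12 z^iz_i\,n$, and this direction is aligned with $K$ iff $z$ solves these equations. The real extended space $\mathbb{R}^{N-2}\cup\{\infty\}$, with $\infty$ corresponding to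 $[n]$, is thereby identified with the set of all real null directions, and a real zero of the alignment equations means an aligned null direction in this extended space. *)

theory Defs
  imports "HOL-Analysis.Analysis"
begin

(* V is the whole type 'v of class real_vector; N is its dimension, passed explicitly.
   Families of N vectors are functions on nat, read only at the indices below N. *)

definition is_basis :: "nat \<Rightarrow> (nat \<Rightarrow> 'v::real_vector) \<Rightarrow> bool" where
  "is_basis N e \<longleftrightarrow>
     inj_on e {..<N} \<and> independent (e ` {..<N}) \<and> span (e ` {..<N}) = UNIV"

(* Signature (N-1,1) via an orthonormal basis, the time-like vector having index 0. *)
definition lorentzian :: "nat \<Rightarrow> ('v::real_vector \<Rightarrow> 'v \<Rightarrow> real) \<Rightarrow> bool" where
  "lorentzian N \<eta> \<longleftrightarrow>
     bilinear \<eta> \<and> (\<forall>u v. \<eta> u v = \<eta> v u) \<and>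
     (\<exists>e. is_basis N e \<and>
        (\<forall>A<N. \<forall>B<N. \<eta> (e A) (e B) = (if A \<noteq> B then 0 else if A = 0 then - 1 else 1)))"

definition bivector :: "('v::real_vector \<Rightarrow> 'v \<Rightarrow> real) \<Rightarrow> bool" where
  "bivector K \<longleftrightarrow> bilinear K \<and> (\<forall>u v. K u v = - K v u)"

definition null_frame ::
    "nat \<Rightarrow> ('v::real_vector \<Rightarrow> 'v \<Rightarrow> real) \<Rightarrow> (nat \<Rightarrow> 'v) \<Rightarrow> bool" where
  "null_frame N \<eta> m \<longleftrightarrow>
     is_basis N m \<and>
     (\<forall>A<N. \<forall>B<N. \<eta> (m A) (m B) =
        (if A = 0 \<and> B = 1 \<or> A = 1 \<and> B = 0 \<or> A = B \<and> 2 \<le> A then 1 else 0))"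

definition null_vector :: "('v::real_vector \<Rightarrow> 'v \<Rightarrow> real) \<Rightarrow> 'v \<Rightarrow> bool" where
  "null_vector \<eta> k \<longleftrightarrow> \<eta> k k = 0"

(* Alignment of the null direction span {k} (for non-zero null k).  Whether the components
   m_0 m_i of K vanish does not depend on the frame, so one frame is as good as all;
   m 0 is automatically non-zero. *)
definition aligned ::
    "nat \<Rightarrow> ('v::real_vector \<Rightarrow> 'v \<Rightarrow> real) \<Rightarrow> ('v \<Rightarrow> 'v \<Rightarrow> real) \<Rightarrow> 'v \<Rightarrow> bool" where
  "aligned N \<eta> K k \<longleftrightarrow>
     (\<exists>m. null_frame N \<eta> m \<and> m 0 \<in> span {k} \<and> (\<forall>i\<in>{2..<N}. K (m 0) (m i) = 0))"

definition alignment_poly ::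
    "nat \<Rightarrow> ('v::real_vector \<Rightarrow> 'v \<Rightarrow> real) \<Rightarrow> (nat \<Rightarrow> 'v) \<Rightarrow> nat \<Rightarrow> (nat \<Rightarrow> real) \<Rightarrow> real" where
  "alignment_poly N K m j z =
     K (m 0) (m j)
     + (\<Sum>i\<in>{2..<N}. z i * K (m i) (m j))
     - z j * K (m 0) (m 1)
     - 1/2 * (\<Sum>i\<in>{2..<N}. z i * z i) * K (m 1) (m j)
     - (\<Sum>i\<in>{2..<N}. z i * z j * K (m i) (m 1))"

(* A point z of R^(N-2) has coordinates z 2, ..., z (N-1) and stands for the null direction of
   m_0 + z^i m_i - (z^i z_i / 2) m_1; Infinity stands for the null direction of m_1. *)
datatype ext_point = Finite "nat \<Rightarrow> real" | Infinity

definition extended_space :: "nat \<Rightarrow> ext_point set" where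
  "extended_space N = insert Infinity (Finite ` ({2..<N} \<rightarrow>\<^sub>E (UNIV :: real set)))"

fun alignment_zero ::
    "nat \<Rightarrow> ('v::real_vector \<Rightarrow> 'v \<Rightarrow> real) \<Rightarrow> ('v \<Rightarrow> 'v \<Rightarrow> real) \<Rightarrow> (nat \<Rightarrow> 'v)
      \<Rightarrow> ext_point \<Rightarrow> bool" where
  "alignment_zero N \<eta> K m (Finite z) \<longleftrightarrow> (\<forall>j\<in>{2..<N}. alignment_poly N K m j z = 0)"
| "alignment_zero N \<eta> K m Infinity \<longleftrightarrow> aligned N \<eta> K (m 1)"

end

theory Submission
  imports Defs "Jordan_Normal_Form.Determinant"
begin

text \<open>
  Alignment of \<open>[k]\<close> means that \<open>k\<close> is a null eigenvector of the \<open>\<eta>\<close>-skew operator given by \<open>K\<close>,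
  i.e. \<open>K k v = l * \<eta> k v\<close> for all \<open>v\<close>. In an orthonormal frame, with \<open>k = e\<^sub>0 + \<Sum> x\<^sub>i e\<^sub>i\<close>, this reads
  \<open>E + B x = (E \<bullet> x) x\<close> with \<open>\<bar>x\<bar> = 1\<close>, where \<open>B\<close> is a skew matrix of odd size \<open>N - 1\<close>.
  For \<open>l > 0\<close> the matrix \<open>l - B\<close> is invertible; put \<open>x\<^sub>l = (l - B)\<^sup>-\<^sup>1 E\<close>. Since \<open>x \<bullet> B x = 0\<close>, any
  \<open>l\<close> with \<open>\<bar>x\<^sub>l\<bar> = 1\<close> solves the equation. As \<open>\<bar>x\<^sub>l\<bar>\<close> is continuous and tends to \<open>0\<close> for large \<open>l\<close>,
  such an \<open>l\<close> exists unless \<open>\<bar>x\<^sub>l\<bar> < 1\<close> throughout. In that case compactness, for \<open>l\<close> tending to \<open>0\<close>,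
  gives \<open>x\<close> with \<open>\<bar>x\<bar> \<le> 1\<close> and \<open>B x = - E\<close>, and adding a kernel vector of \<open>B\<close>, which exists
  because the size is odd, moves \<open>x\<close> to the unit sphere.
\<close>

unbundle no vec_syntax

subsection \<open>Skew matrices of odd size\<close>

text \<open>A trivial kernel makes the determinant non-zero, and then the adjugate divided by the
  determinant solves the system. The form with functions on \<open>nat\<close> keeps matrices out of
  the later arguments.\<close>

lemma square_system_solvable:
  fixes a :: "nat \<Rightarrow> nat \<Rightarrow> real"
  assumes inj: "\<And>x. (\<And>i. i < n \<Longrightarrow> (\<Sum>j<n. a i j * x j) = 0) \<Longrightarrow> \<forall>i<n. x i = 0"
  shows "\<exists>x. \<forall>i<n. (\<Sum>j<n. a i j * x j) = b i"
proof -
  define A where "A = Matrix.mat n n (\<lambda>(i,j). a i j)"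
  have A: "A \<in> carrier_mat n n" by (simp add: A_def)
  have mult: "(A *\<^sub>v v) $ i = (\<Sum>j<n. a i j * v $ j)" if "i < n" "v \<in> carrier_vec n" for i v
    using that by (auto simp: A_def scalar_prod_def lessThan_atLeast0 intro!: sum.cong)
  have det: "Determinant.det A \<noteq> 0"
  proof
    assume "Determinant.det A = 0"
    then obtain v where v: "v \<in> carrier_vec n" "v \<noteq> 0\<^sub>v n" "A *\<^sub>v v = 0\<^sub>v n"
      using det_0_iff_vec_prod_zero_field[OF A] by blast
    have "\<forall>i<n. v $ i = 0"
      using mult v by (intro inj) (metis index_zero_vec(1))
    then have "v = 0\<^sub>v n" using v(1) by (intro eq_vecI) auto
    with v(2) show False by simp
  qed
  define y where "y = adj_mat A *\<^sub>v Matrix.vec n b"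
  define x where "x = (1 / Determinant.det A) \<cdot>\<^sub>v y"
  have y: "y \<in> carrier_vec n" 
    unfolding y_def using adj_mat(1)[OF A] by auto
  have "A *\<^sub>v y = (A * adj_mat A) *\<^sub>v Matrix.vec n b"
    unfolding y_def using adj_mat(1)[OF A] A by (simp add: assoc_mult_mat_vec)
  also have "\<dots> = Determinant.det A \<cdot>\<^sub>v Matrix.vec n b"
    unfolding adj_mat(2)[OF A] by (intro eq_vecI) auto
  finally have "A *\<^sub>v x = Matrix.vec n b"
    unfolding x_def using det mult_mat_vec[OF A y]
    by (simp add: smult_smult_assoc)
  moreover have "x \<in> carrier_vec n" using y by (simp add: x_def)
  ultimately have "\<forall>i<n. (\<Sum>j<n. a i j * x $ j) = b i"
    by (metis mult index_vec)
  then show ?thesis by (intro exI[of _ "\<lambda>j. x $ j"])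
qed

text \<open>For odd \<open>n\<close>, det A = det A^T = det (-A) = - det A, so A is
  singular.\<close>

lemma odd_skew_kernel:
  fixes B :: "nat \<Rightarrow> nat \<Rightarrow> real"
  assumes "odd n" and skew: "\<forall>i j. B i j = - B j i"
  shows "\<exists>x. (\<exists>i<n. x i \<noteq> 0) \<and> (\<forall>i<n. (\<Sum>j<n. B i j * x j) = 0)"
proof -
  define A where "A = Matrix.mat n n (\<lambda>(i,j). B i j)"
  have A: "A \<in> carrier_mat n n" by (simp add: A_def)
  have mult: "(A *\<^sub>v v) $ i = (\<Sum>j<n. B i j * v $ j)" if "i < n" "v \<in> carrier_vec n" for i v
    using that by (auto simp: A_def scalar_prod_def lessThan_atLeast0 intro!: sum.cong)
  have "transpose_mat A = (-1) \<cdot>\<^sub>m A"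
    by (intro eq_matI) (auto simp: A_def intro: skew[rule_format])
  then have "Determinant.det A = (-1) ^ n * Determinant.det A"
    using det_transpose[OF A] A by (metis carrier_matD(2) det_smult)
  then have "Determinant.det A = 0" using \<open>odd n\<close> by simp
  then obtain v where v: "v \<in> carrier_vec n" "v \<noteq> 0\<^sub>v n" "A *\<^sub>v v = 0\<^sub>v n"
    using det_0_iff_vec_prod_zero_field[OF A] by blast
  have "\<exists>i<n. v $ i \<noteq> 0"
    using v(1,2) by (metis carrier_vecD eq_vecI index_zero_vec)
  moreover have "\<forall>i<n. (\<Sum>j<n. B i j * v $ j) = 0"
    using v mult by (metis index_zero_vec(1))
  ultimately show ?thesis by blast
qed

section \<open>The resolvent of a skew matrix\<close>

lemma skew_quadratic_zero:
  fixes B :: "nat \<Rightarrow> nat \<Rightarrow> real"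
  assumes skew: "\<forall>i j. B i j = - B j i"
  shows "(\<Sum>i<n. x i * (\<Sum>j<n. B i j * x j)) = 0"
proof -
  let ?S = "\<Sum>i<n. \<Sum>j<n. x i * (B i j * x j)"
  have "?S = (\<Sum>j<n. \<Sum>i<n. x i * (B i j * x j))" by (rule sum.swap)
  also have "\<dots> = (\<Sum>j<n. \<Sum>i<n. - (x j * (B j i * x i)))"
    by (intro sum.cong refl) (subst skew[rule_format], simp)
  also have "\<dots> = - ?S" by (simp add: sum_negf)
  finally show ?thesis by (simp add: sum_distrib_left)
qed

text \<open>Pairing the equation with \<open>x\<close> kills the \<open>B\<close> term and leaves l
  |x|^2 = x.w; Cauchy-Schwarz does the rest. The estimate serves three times: \<open>w = 0\<close>
  for injectivity, \<open>w = E\<close> for decay in \<open>l\<close>, and a difference of two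
  resolvents for continuity.\<close>

lemma skew_resolvent_bound:
  fixes B :: "nat \<Rightarrow> nat \<Rightarrow> real"
  assumes skew: "\<forall>i j. B i j = - B j i"
    and eq: "\<And>i. i < n \<Longrightarrow> l * x i - (\<Sum>j<n. B i j * x j) = w i"
  shows "l * L2_set x {..<n} \<le> L2_set w {..<n}"
proof -
  let ?X = "L2_set x {..<n}" and ?W = "L2_set w {..<n}"
  have "(\<Sum>i<n. x i * w i) = (\<Sum>i<n. x i * (l * x i - (\<Sum>j<n. B i j * x j)))"
    by (intro sum.cong refl) (simp add: eq)
  also have "\<dots> = l * (\<Sum>i<n. (x i)\<^sup>2)"
    using skew_quadratic_zero[OF skew, of x n]
    by (simp add: right_diff_distrib sum_subtractf sum_distrib_left power2_eq_square mult.left_commute)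
  also have "(\<Sum>i<n. (x i)\<^sup>2) = ?X * ?X"
    by (simp add: L2_set_def sum_nonneg)
  finally have "l * ?X * ?X = (\<Sum>i<n. x i * w i)" by simp
  also have "\<dots> \<le> (\<Sum>i<n. \<bar>x i\<bar> * \<bar>w i\<bar>)"
    by (intro sum_mono) (metis abs_ge_self abs_mult)
  also have "\<dots> \<le> ?W * ?X"
    using L2_set_mult_ineq[of x w "{..<n}"] by (simp add: mult.commute)
  finally have *: "l * ?X * ?X \<le> ?W * ?X" .
  show ?thesis
  proof (cases "?X = 0")
    case False
    then have "?X > 0" by (simp add: less_le)
    with * show ?thesis by simp
  qed simp
qed

lemma skew_resolvent_exists:
  fixes B :: "nat \<Rightarrow> nat \<Rightarrow> real"
  assumes skew: "\<forall>i j. B i j = - B j i" and "l > 0"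
  shows "\<exists>x. \<forall>i<n. l * x i - (\<Sum>j<n. B i j * x j) = E i"
proof -
  define a where "a i j = (if i = j then l else 0) - B i j" for i j
  have a: "(\<Sum>j<n. a i j * x j) = l * x i - (\<Sum>j<n. B i j * x j)" if "i < n" for i x
  proof -
    have "(\<Sum>j<n. a i j * x j) = (\<Sum>j<n. (if i = j then l * x j else 0) - B i j * x j)"
      by (intro sum.cong) (auto simp: a_def algebra_simps)
    with that show ?thesis by (simp add: sum_subtractf)
  qed
  have "\<exists>x. \<forall>i<n. (\<Sum>j<n. a i j * x j) = E i"
  proof (rule square_system_solvable)
    fix x assume 0: "\<And>i. i < n \<Longrightarrow> (\<Sum>j<n. a i j * x j) = 0"
    have "l * L2_set x {..<n} \<le> L2_set (\<lambda>_. 0) {..<n}"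
      using 0 a by (intro skew_resolvent_bound[OF skew]) simp
    then have "L2_set x {..<n} \<le> 0"
      using \<open>l > 0\<close> by (simp add: L2_set_def mult_le_0_iff)
    then have "L2_set x {..<n} = 0" by (simp add: order_antisym)
    then show "\<forall>i<n. x i = 0" by (simp add: L2_set_eq_0_iff)
  qed
  then show ?thesis by (simp add: a)
qed

section \<open>The limit as l tends to 0, and the unit sphere\<close>

text \<open>The quadratic condition leaves coordinates from \<open>n\<close> on free, so a box in
  all coordinates supplies compactness by Tychonoff; the condition itself is closed.\<close>

lemma compact_unit_ball_coordinates:
  "compact {x :: nat \<Rightarrow> real. x \<in> UNIV \<rightarrow>\<^sub>E {-1..1} \<and> (\<Sum>i<n. (x i)\<^sup>2) \<le> 1}"
proof -
  have "compact (UNIV \<rightarrow>\<^sub>E {-1..1::real} :: (nat \<Rightarrow> real) set)"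
    using compactin_PiE[of "\<lambda>_::nat. euclideanreal" UNIV "\<lambda>_. {-1..1}"]
    by (simp add: euclidean_product_topology)
  moreover have "closed {x::nat \<Rightarrow> real. (\<Sum>i<n. (x i)\<^sup>2) \<le> 1}"
    by (intro closed_Collect_le continuous_intros continuous_on_product_coordinates)
  ultimately have "compact ((UNIV \<rightarrow>\<^sub>E {-1..1}) \<inter> {x::nat \<Rightarrow> real. (\<Sum>i<n. (x i)\<^sup>2) \<le> 1})"
    by (rule compact_Int_closed)
  then show ?thesis by (simp only: Collect_conj_eq Collect_mem_eq)
qed

text \<open>Minimising g = |B x + E|^2 over the compact ball replaces the extraction of a convergent
  subsequence: at \<open>X l\<close> its value is l^2 |X l|^2, at most l^2, so the attained minimum
  is 0.\<close>

lemma skew_range_limit: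
  fixes B :: "nat \<Rightarrow> nat \<Rightarrow> real"
  assumes eq: "\<And>l i. l > 0 \<Longrightarrow> i < n \<Longrightarrow> l * X l i - (\<Sum>j<n. B i j * X l j) = E i"
    and small: "\<And>l. l > 0 \<Longrightarrow> (\<Sum>i<n. (X l i)\<^sup>2) \<le> 1"
  shows "\<exists>x. (\<Sum>i<n. (x i)\<^sup>2) \<le> 1 \<and> (\<forall>i<n. (\<Sum>j<n. B i j * x j) = - E i)"
proof -
  let ?C = "{x :: nat \<Rightarrow> real. x \<in> UNIV \<rightarrow>\<^sub>E {-1..1} \<and> (\<Sum>i<n. (x i)\<^sup>2) \<le> 1}"
  define g :: "(nat \<Rightarrow> real) \<Rightarrow> real" where
    "g x = (\<Sum>i<n. ((\<Sum>j<n. B i j * x j) + E i)\<^sup>2)" for x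
  have "continuous_on UNIV g"
    unfolding g_def by (intro continuous_intros continuous_on_product_coordinates)
  then have "continuous_on ?C g" by (rule continuous_on_subset) simp
  moreover have "(\<lambda>_. 0) \<in> ?C" by auto
  ultimately obtain x where x: "x \<in> ?C" "\<And>y. y \<in> ?C \<Longrightarrow> g x \<le> g y"
    using continuous_attains_inf[OF compact_unit_ball_coordinates, of n g] by blast
  have bound: "g x \<le> l\<^sup>2" if "l > 0" for l
  proof -
    \<comment> \<open>\<open>X l\<close> is arbitrary at indices from \<open>n\<close> on; cutting
      it off there puts it into the box and changes none of the sums.\<close>
    define y where "y = (\<lambda>i. if i < n then X l i else 0)"
    have y: "(\<Sum>i<n. (y i)\<^sup>2) \<le> 1" using small[OF that] by (simp add: y_def)
    have "y i \<in> {-1..1}" for i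
    proof (cases "i < n")
      case True
      then have "(y i)\<^sup>2 \<le> (\<Sum>i<n. (y i)\<^sup>2)" by (intro member_le_sum) auto
      with y have "(y i)\<^sup>2 \<le> 1" by simp
      then have "\<bar>y i\<bar> \<le> 1" by (simp add: abs_square_le_1)
      then show ?thesis by (simp add: abs_le_iff)
    qed (simp add: y_def)
    with y have "g x \<le> g y" by (intro x) auto
    also have "g y = (\<Sum>i<n. (l * y i)\<^sup>2)"
      unfolding g_def using eq[OF that] by (intro sum.cong refl) (simp add: y_def algebra_simps)
    also have "\<dots> = l\<^sup>2 * (\<Sum>i<n. (y i)\<^sup>2)"
      by (simp add: power_mult_distrib sum_distrib_left)
    also have "\<dots> \<le> l\<^sup>2" using y by (simp add: mult_left_le)
    finally show ?thesis .
  qed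
  have "g x \<le> 0"
  proof (rule ccontr)
    assume "\<not> g x \<le> 0"
    \<comment> \<open>For this \<open>l\<close> the bound reads g x \<le> g x / 2, which fails for
      positive g x.\<close>
    with bound[of "sqrt (g x / 2)"] show False by simp
  qed
  then have "g x = 0" by (simp add: g_def order_antisym sum_nonneg)
  then have "\<forall>i<n. (\<Sum>j<n. B i j * x j) + E i = 0"
    by (simp add: g_def sum_nonneg_eq_0_iff)
  then show ?thesis using x(1) by (intro exI[of _ x]) (auto simp: add_eq_0_iff)
qed

text \<open>Moving along the kernel direction \<open>w\<close> does not change \<open>B x\<close>.\<close>

lemma kernel_shift_to_sphere:
  fixes x w :: "nat \<Rightarrow> real"
  assumes "(\<Sum>i<n. (x i)\<^sup>2) \<le> 1" and "k < n" "w k \<noteq> 0"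
  shows "\<exists>t. (\<Sum>i<n. (x i + t * w i)\<^sup>2) = 1"
proof -
  \<comment> \<open>With this \<open>T\<close> the shift of coordinate \<open>k\<close> has absolute
    value 1 + |x k|, so that coordinate alone already leaves the open unit ball.\<close>
  define T where "T = (1 + \<bar>x k\<bar>) / \<bar>w k\<bar>"
  let ?f = "\<lambda>t. \<Sum>i<n. (x i + t * w i)\<^sup>2"
  have "T \<ge> 0" by (simp add: T_def)
  have "\<bar>T * w k\<bar> = 1 + \<bar>x k\<bar>" using assms(3) by (simp add: T_def abs_mult)
  then have "1 \<le> \<bar>x k + T * w k\<bar>" by linarith
  then have "1 \<le> (x k + T * w k)\<^sup>2"
    by (metis abs_le_square_iff abs_one one_power2)
  also have "\<dots> \<le> ?f T" using assms(2) by (intro member_le_sum) auto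
  finally have "1 \<le> ?f T" .
  moreover have "?f 0 \<le> 1" using assms(1) by simp
  moreover have "continuous_on {0..T} ?f" by (intro continuous_intros)
  ultimately show ?thesis using IVT'[of ?f 0 1 T] \<open>T \<ge> 0\<close> by blast
qed

text \<open>The norm of \<open>X l\<close> is at least 1 at \<open>a\<close> and at most 1 for large
  \<open>l\<close>, so the intermediate value theorem applies once it is continuous. Continuity
  comes from the resolvent identity, as a Lipschitz bound.\<close>

lemma skew_resolvent_unit:
  fixes B :: "nat \<Rightarrow> nat \<Rightarrow> real"
  assumes skew: "\<forall>i j. B i j = - B j i"
    and eq: "\<And>l i. l > 0 \<Longrightarrow> i < n \<Longrightarrow> l * X l i - (\<Sum>j<n. B i j * X l j) = E i"
    and "a > 0" and large: "L2_set (X a) {..<n} \<ge> 1"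
  shows "\<exists>l>0. L2_set (X l) {..<n} = 1"
proof -
  let ?N = "\<lambda>v. L2_set v {..<n}"
  \<comment> \<open>At \<open>b\<close> the decay bound gives norm at most 1, since b \<ge> |E|; the
    maximum with \<open>a\<close> keeps the interval non-empty.\<close>
  define b where "b = max a (?N E)"
  have bd: "l * ?N (X l) \<le> ?N E" if "l > 0" for l
    using eq[OF that] by (rule skew_resolvent_bound[OF skew])
  have lip: "?N (X l) \<le> ?N (X m) + ?N E / a\<^sup>2 * \<bar>l - m\<bar>" if "l \<ge> a" "m \<ge> a" for l m
  proof -
    have pos: "l > 0" "m > 0" using that \<open>a > 0\<close> by auto
    \<comment> \<open>Resolvent identity: (m - B) d = (m - l) X l. Combined with |X l| \<le> |E| / l
      and l, m \<ge> a it yields the constant |E| / a^2.\<close>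
    let ?d = "\<lambda>i. X l i - X m i"
    have "m * ?N ?d \<le> ?N (\<lambda>i. (m - l) * X l i)"
      by (rule skew_resolvent_bound[OF skew])
        (use eq[OF pos(1)] eq[OF pos(2)] in \<open>auto simp: right_diff_distrib left_diff_distrib sum_subtractf algebra_simps\<close>)
    also have "\<dots> = \<bar>l - m\<bar> * ?N (X l)"
      by (simp add: L2_set_def power_mult_distrib real_sqrt_mult abs_minus_commute flip: sum_distrib_left)
    finally have "m * ?N ?d \<le> \<bar>l - m\<bar> * ?N (X l)" .
    moreover have "a * ?N ?d \<le> m * ?N ?d" using that by (simp add: mult_right_mono)
    moreover have "a * ?N (X l) \<le> l * ?N (X l)" using that by (simp add: mult_right_mono)
    ultimately have 1: "a * ?N ?d \<le> \<bar>l - m\<bar> * ?N (X l)" and 2: "a * ?N (X l) \<le> ?N E"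
      using bd[OF pos(1)] by linarith+
    have "?N (X l) \<le> ?N E / a" using 2 \<open>a > 0\<close> by (simp add: field_simps)
    then have "a * ?N ?d \<le> \<bar>l - m\<bar> * (?N E / a)"
      using 1 by (meson abs_ge_zero mult_left_mono order_trans)
    then have "?N ?d \<le> ?N E / a\<^sup>2 * \<bar>l - m\<bar>"
      using \<open>a > 0\<close> by (simp add: field_simps power2_eq_square)
    moreover have "?N (X l) \<le> ?N (X m) + ?N ?d"
      using L2_set_triangle_ineq[of "X m" ?d "{..<n}"] by simp
    ultimately show ?thesis by linarith
  qed
  have "(?N E / a\<^sup>2)-lipschitz_on {a..b} (\<lambda>l. ?N (X l))"
  proof (rule lipschitz_onI)
    fix l m assume "l \<in> {a..b}" "m \<in> {a..b}"
    then show "dist (?N (X l)) (?N (X m)) \<le> ?N E / a\<^sup>2 * dist l m"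
      using lip[of l m] lip[of m l] by (simp add: dist_real_def abs_minus_commute abs_le_iff)
  qed (simp add: L2_set_nonneg)
  then have "continuous_on {a..b} (\<lambda>l. ?N (X l))" by (rule lipschitz_on_continuous_on)
  moreover have "?N (X b) \<le> 1"
  proof -
    have "b > 0" using \<open>a > 0\<close> by (simp add: b_def)
    moreover have "b * ?N (X b) \<le> b" using bd[OF \<open>b > 0\<close>] by (simp add: b_def)
    ultimately show ?thesis by (simp add: mult_le_cancel_left1)
  qed
  ultimately obtain l where "l \<ge> a" "?N (X l) = 1"
    using IVT2'[of "\<lambda>l. ?N (X l)" b 1 a] large by (auto simp: b_def)
  then show ?thesis using \<open>a > 0\<close> by (intro exI[of _ l]) auto
qed

text \<open>Since x.Bx = 0, the field E + B x - (E.x) x is tangent to the unit sphere, which has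
  even dimension n - 1. The lemma finds a zero of this particular field by elementary means, in
  place of the hairy ball theorem.\<close>

lemma odd_sphere_field_zero:
  fixes B :: "nat \<Rightarrow> nat \<Rightarrow> real" and E :: "nat \<Rightarrow> real"
  assumes "odd n" and skew: "\<forall>i j. B i j = - B j i"
  shows "\<exists>x. (\<Sum>i<n. (x i)\<^sup>2) = 1 \<and>
    (\<forall>j<n. E j + (\<Sum>i<n. B j i * x i) = (\<Sum>i<n. E i * x i) * x j)"
proof -
  \<comment> \<open>Pairing (l - B) x = E with a unit vector x shows l = E.x, so any unit solution
    will do, whatever \<open>l\<close>. The value 0 is used below for the limiting case.\<close>
  have unit: ?thesis
    if "(\<Sum>i<n. (x i)\<^sup>2) = 1" and x: "\<And>j. j < n \<Longrightarrow> l * x j - (\<Sum>i<n. B j i * x i) = E j" for x l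
  proof -
    have "(\<Sum>i<n. E i * x i) = (\<Sum>i<n. l * (x i)\<^sup>2 - x i * (\<Sum>j<n. B i j * x j))"
      by (intro sum.cong refl) (simp add: x[symmetric] power2_eq_square algebra_simps)
    also have "\<dots> = l"
      using that(1) skew_quadratic_zero[OF skew, of x n]
      by (simp add: sum_subtractf flip: sum_distrib_left)
    finally have "(\<Sum>i<n. E i * x i) = l" .
    moreover have "E j + (\<Sum>i<n. B j i * x i) = l * x j" if "j < n" for j
      using x[OF that] by linarith
    ultimately show ?thesis using that(1) by (intro exI[of _ x]) simp
  qed
  have "\<forall>l>0. \<exists>x. \<forall>i<n. l * x i - (\<Sum>j<n. B i j * x j) = E i"
    using skew_resolvent_exists[OF skew] by blast
  then obtain X where X: "\<And>l i. l > 0 \<Longrightarrow> i < n \<Longrightarrow> l * X l i - (\<Sum>j<n. B i j * X l j) = E i"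
    by metis
  show ?thesis
  proof (cases "\<exists>a>0. L2_set (X a) {..<n} \<ge> 1")
    case True
    then obtain l where "l > 0" "L2_set (X l) {..<n} = 1"
      using skew_resolvent_unit[where X = X, OF skew X] by blast
    then show ?thesis using X[of l] by (intro unit[of "X l" l]) (simp_all add: L2_set_def)
  next
    case False
    then have "(\<Sum>i<n. (X l i)\<^sup>2) \<le> 1" if "l > 0" for l
      using that by (auto simp: L2_set_def not_le intro: less_imp_le)
    from skew_range_limit[where X = X, OF X this] obtain x where
      x: "(\<Sum>i<n. (x i)\<^sup>2) \<le> 1" "\<And>i. i < n \<Longrightarrow> (\<Sum>j<n. B i j * x j) = - E i"
      by blast
    obtain w k where w: "k < n" "w k \<noteq> 0" "\<And>i. i < n \<Longrightarrow> (\<Sum>j<n. B i j * w j) = 0"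
      using odd_skew_kernel[OF assms] by blast
    obtain t where t: "(\<Sum>i<n. (x i + t * w i)\<^sup>2) = 1"
      using kernel_shift_to_sphere[of x n k w] x(1) w(1,2) by blast
    have "(\<Sum>i<n. B j i * (x i + t * w i)) = - E j" if "j < n" for j
    proof -
      have "(\<Sum>i<n. B j i * (x i + t * w i)) = (\<Sum>i<n. B j i * x i) + t * (\<Sum>i<n. B j i * w i)"
        by (simp add: algebra_simps sum.distrib sum_distrib_left)
      then show ?thesis using x(2) w(3) that by simp
    qed
    then show ?thesis using t by (intro unit[of _ 0]) auto
  qed
qed

subsection \<open>Null frames\<close>

lemma bilinear_lsum_scaleR:
  fixes h :: "'v::real_vector \<Rightarrow> 'v \<Rightarrow> real"
  assumes "bilinear h"
  shows "h (\<Sum>i\<in>S. c i *\<^sub>R f i) v = (\<Sum>i\<in>S. c i * h (f i) v)"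
proof -
  have lin: "linear (\<lambda>u. h u v)" using assms by (simp add: bilinear_def)
  show ?thesis by (simp add: linear_sum[OF lin] linear_cmul[OF lin])
qed

lemmas bilinear_simps =
  bilinear_lsum_scaleR bilinear_ladd bilinear_radd bilinear_lsub bilinear_rsub
  bilinear_lmul bilinear_rmul

lemma is_basis_expansion:
  assumes "is_basis N m"
  shows "\<exists>c. v = (\<Sum>A<N. c A *\<^sub>R m A)"
proof -
  have "v \<in> span (m ` {..<N})" and inj: "inj_on m {..<N}"
    using assms by (auto simp: is_basis_def)
  then obtain u where "v = (\<Sum>w\<in>m ` {..<N}. u w *\<^sub>R w)"
    by (auto simp: span_finite)
  then have "v = (\<Sum>A<N. u (m A) *\<^sub>R m A)"
    by (simp add: sum.reindex[OF inj])
  then show ?thesis by (intro exI[of _ "\<lambda>A. u (m A)"])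
qed

text \<open>The known basis \<open>e\<close> serves to bound the dimension: a vector outside the
  span of \<open>m\<close> would give N + 1 independent vectors in the span of N.\<close>

lemma is_basisI:
  fixes e m :: "nat \<Rightarrow> 'v::real_vector"
  assumes e: "is_basis N e"
    and zero: "\<And>c A. (\<Sum>A<N. c A *\<^sub>R m A) = 0 \<Longrightarrow> A < N \<Longrightarrow> c A = 0"
  shows "is_basis N m"
proof -
  have inj: "inj_on m {..<N}"
  proof (rule inj_onI, rule ccontr)
    fix A B assume AB: "A \<in> {..<N}" "B \<in> {..<N}" "m A = m B" "A \<noteq> B"
    define c where "c C = (if C = A then 1 else 0) - (if C = B then 1 else 0 :: real)" for C
    have "(\<Sum>C<N. c C *\<^sub>R m C)
        = (\<Sum>C<N. (if C = A then m C else 0) - (if C = B then m C else 0))"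
      by (intro sum.cong) (auto simp: c_def algebra_simps)
    also have "\<dots> = 0" using AB by (simp add: sum_subtractf)
    finally have "c A = 0" using AB by (intro zero) auto
    with AB show False by (simp add: c_def)
  qed
  have ind: "independent (m ` {..<N})"
  proof (rule independent_if_scalars_zero)
    fix f x assume "(\<Sum>x\<in>m ` {..<N}. f x *\<^sub>R x) = 0" "x \<in> m ` {..<N}"
    then show "f x = 0"
      using zero[of "\<lambda>A. f (m A)"] by (auto simp: sum.reindex[OF inj])
  qed simp
  have "v \<in> span (m ` {..<N})" for v
  proof (rule ccontr)
    assume v: "v \<notin> span (m ` {..<N})"
    then have "independent (insert v (m ` {..<N}))"
      using ind by (rule independent_insertI)
    moreover have "insert v (m ` {..<N}) \<subseteq> span (e ` {..<N})"
      using e by (simp add: is_basis_def)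
    ultimately have "card (insert v (m ` {..<N})) \<le> card (e ` {..<N})"
      using independent_span_bound by blast
    moreover have "card (insert v (m ` {..<N})) = Suc N"
      using v inj by (simp add: card_insert_if card_image span_base)
        (metis imageI lessThan_iff span_base)
    moreover have "card (e ` {..<N}) \<le> N"
      using card_image_le[of "{..<N}" e] by simp
    ultimately show False by simp
  qed
  with inj ind show ?thesis by (auto simp: is_basis_def)
qed

text \<open>The Gram matrix of a null frame is the permutation matrix of this involution, so pairing
  with \<open>m (null_dual A)\<close> reads off the coefficient of \<open>m A\<close>. This gives
  one formula for all products.\<close>

definition null_dual :: "nat \<Rightarrow> nat" where
  "null_dual A = (if A = 0 then 1 else if A = 1 then 0 else A)"

lemma null_frame_iff_dual:
  "null_frame N \<eta> m \<longleftrightarrow>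
    is_basis N m \<and> (\<forall>A<N. \<forall>B<N. \<eta> (m A) (m B) = (if A = null_dual B then 1 else 0))"
proof -
  have "(A = 0 \<and> B = 1 \<or> A = 1 \<and> B = 0 \<or> A = B \<and> 2 \<le> A) \<longleftrightarrow> A = null_dual B" for A B
    by (auto simp: null_dual_def)
  then show ?thesis by (simp add: null_frame_def)
qed

lemma null_dual_less: "N \<ge> 2 \<Longrightarrow> A < N \<Longrightarrow> null_dual A < N"
  by (simp add: null_dual_def)

lemma null_dual_null_dual [simp]: "null_dual (null_dual A) = A"
  by (simp add: null_dual_def)

lemma null_frameI:
  fixes e m :: "nat \<Rightarrow> 'v::real_vector" and \<eta> :: "'v::real_vector \<Rightarrow> 'v \<Rightarrow> real"
  assumes "bilinear \<eta>" "N \<ge> 2" "is_basis N e"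
    and prod: "\<And>A B. A < N \<Longrightarrow> B < N \<Longrightarrow> \<eta> (m A) (m B) = (if A = null_dual B then 1 else 0)"
  shows "null_frame N \<eta> m"
proof -
  have "is_basis N m"
  proof (rule is_basisI[OF assms(3)])
    fix c A assume 0: "(\<Sum>A<N. c A *\<^sub>R m A) = 0" and A: "A < N"
    have "0 = \<eta> (\<Sum>A<N. c A *\<^sub>R m A) (m (null_dual A))"
      using assms(1) by (simp add: 0 bilinear_lzero)
    also have "\<dots> = (\<Sum>B<N. c B * (if B = A then 1 else 0))"
      unfolding bilinear_lsum_scaleR[OF assms(1)]
      using prod null_dual_less[OF assms(2) A] by (intro sum.cong) auto
    also have "\<dots> = c A" using A by (simp add: if_distrib cong: if_cong)
    finally show "c A = 0" by simp
  qed
  with prod show ?thesis by (simp add: null_frame_iff_dual)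
qed

text \<open>\<open>aligned\<close> asks for a frame whose vector 0 spans the direction; exchanging
  the two null vectors provides one for \<open>m 1\<close>.\<close>

lemma null_frame_swap:
  fixes \<eta> :: "'v::real_vector \<Rightarrow> 'v \<Rightarrow> real"
  assumes "bilinear \<eta>" "N \<ge> 2" "null_frame N \<eta> m"
  shows "null_frame N \<eta> (\<lambda>A. m (null_dual A))"
proof (rule null_frameI[OF assms(1,2)])
  show "is_basis N m" using assms(3) by (simp add: null_frame_def)
  show "\<eta> (m (null_dual A)) (m (null_dual B)) = (if A = null_dual B then 1 else 0)"
    if "A < N" "B < N" for A B
    using assms(2,3) that null_dual_less[OF assms(2)]
    by (auto simp: null_frame_iff_dual)
qed

section \<open>Null directions as points of the extended space\<close>

definition null_point :: "nat \<Rightarrow> (nat \<Rightarrow> 'v::real_vector) \<Rightarrow> (nat \<Rightarrow> real) \<Rightarrow> 'v" where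
  "null_point N m z =
     m 0 + (\<Sum>i\<in>{2..<N}. z i *\<^sub>R m i) - (1/2 * (\<Sum>i\<in>{2..<N}. z i * z i)) *\<^sub>R m 1"

lemma null_point_products:
  fixes \<eta> :: "'v::real_vector \<Rightarrow> 'v \<Rightarrow> real"
  assumes bil: "bilinear \<eta>" and "N \<ge> 2" and m: "null_frame N \<eta> m"
  shows "\<eta> (null_point N m z) (m 0) = - 1/2 * (\<Sum>i\<in>{2..<N}. z i * z i)"
    and "\<eta> (null_point N m z) (m 1) = 1"
    and "j \<in> {2..<N} \<Longrightarrow> \<eta> (null_point N m z) (m j) = z j"
proof -
  have mm: "\<eta> (m A) (m B) = (if A = null_dual B then 1 else 0)" if "A < N" "B < N" for A B
    using m that by (simp add: null_frame_iff_dual)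
  have *: "\<eta> (null_point N m z) (m B) = \<eta> (m 0) (m B) + (\<Sum>i\<in>{2..<N}. z i * \<eta> (m i) (m B))
      - 1/2 * (\<Sum>i\<in>{2..<N}. z i * z i) * \<eta> (m 1) (m B)" for B
    unfolding null_point_def using bil by (simp add: bilinear_simps)
  have sums: "(\<Sum>i\<in>{2..<N}. z i * \<eta> (m i) (m B)) = (if B \<in> {2..<N} then z B else 0)"
    if "B < N" for B
  proof -
    have "(\<Sum>i\<in>{2..<N}. z i * \<eta> (m i) (m B)) = (\<Sum>i\<in>{2..<N}. if i = B then z i else 0)"
      using that by (intro sum.cong) (auto simp: mm null_dual_def)
    then show ?thesis by simp
  qed
  have m01: "\<eta> (m 0) (m 0) = 0" "\<eta> (m 0) (m 1) = 1" "\<eta> (m 1) (m 0) = 1" "\<eta> (m 1) (m 1) = 0"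
    using \<open>N \<ge> 2\<close> mm[of 0 0] mm[of 0 1] mm[of 1 0] mm[of 1 1] by (simp_all add: null_dual_def)
  show "\<eta> (null_point N m z) (m 0) = - 1/2 * (\<Sum>i\<in>{2..<N}. z i * z i)"
    and "\<eta> (null_point N m z) (m 1) = 1"
    and "j \<in> {2..<N} \<Longrightarrow> \<eta> (null_point N m z) (m j) = z j"
    using \<open>N \<ge> 2\<close> sums[of 0] sums[of 1] sums[of j] m01
      mm[of 0 j] mm[of 1 j] by (simp_all add: * null_dual_def)
qed

lemma null_point_null:
  fixes \<eta> :: "'v::real_vector \<Rightarrow> 'v \<Rightarrow> real"
  assumes bil: "bilinear \<eta>" and sym: "\<And>u v. \<eta> u v = \<eta> v u"
    and "N \<ge> 2" and m: "null_frame N \<eta> m"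
  shows "\<eta> (null_point N m z) (null_point N m z) = 0"
proof -
  let ?k = "null_point N m z"
  note kp = null_point_products[OF bil assms(3) m, where z = z]
  have "\<eta> ?k ?k = \<eta> (m 0) ?k + (\<Sum>i\<in>{2..<N}. z i * \<eta> (m i) ?k)
      - 1/2 * (\<Sum>i\<in>{2..<N}. z i * z i) * \<eta> (m 1) ?k"
    by (subst null_point_def) (simp add: bilinear_simps[OF bil])
  also have "(\<Sum>i\<in>{2..<N}. z i * \<eta> (m i) ?k) = (\<Sum>i\<in>{2..<N}. z i * z i)"
    using kp(3) by (intro sum.cong) (auto simp: sym[of "m i" for i])
  finally show ?thesis
    using kp(1,2) by (simp add: sym[of "m i" for i])
qed

text \<open>This is the null rotation fixing \<open>m 1\<close>. Subtracting \<open>z A\<close>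
  times \<open>m 1\<close> restores orthogonality to the new vector 0, because the null point has
  product \<open>z A\<close> with \<open>m A\<close> and 1 with \<open>m 1\<close>.\<close>

lemma null_frame_rotate:
  fixes \<eta> :: "'v::real_vector \<Rightarrow> 'v \<Rightarrow> real"
  assumes bil: "bilinear \<eta>" and sym: "\<And>u v. \<eta> u v = \<eta> v u"
    and N: "N \<ge> 2" and m: "null_frame N \<eta> m"
  shows "null_frame N \<eta>
    (\<lambda>A. if A = 0 then null_point N m z else if A = 1 then m 1 else m A - z A *\<^sub>R m 1)"
    (is "null_frame N \<eta> ?m")
proof (rule null_frameI[OF bil N])
  show "is_basis N m" using m by (simp add: null_frame_def)
  let ?k = "null_point N m z"
  have mm: "\<eta> (m A) (m B) = (if A = null_dual B then 1 else 0)" if "A < N" "B < N" for A B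
    using m that by (simp add: null_frame_iff_dual)
  note kp = null_point_products[OF bil N m, where z = z]
  have kk: "\<eta> ?k ?k = 0" by (rule null_point_null[OF bil sym N m])
  have k1: "\<eta> ?k (m 1 :: 'v) = 1" "\<eta> (m 1) ?k = 1"
    using kp(2) sym[of "m 1" ?k] by simp_all
  have kw: "\<eta> ?k (m i - z i *\<^sub>R m 1) = 0" "\<eta> (m i - z i *\<^sub>R m 1) ?k = 0"
    if "i < N" "2 \<le> i" for i
    using that kp(2) kp(3)[of i] by (simp_all add: sym[of _ ?k] bilinear_simps[OF bil])
  have m1: "\<eta> (m 1) (m 1) = 0" "i < N \<Longrightarrow> 2 \<le> i \<Longrightarrow> \<eta> (m 1) (m i) = 0"
    "i < N \<Longrightarrow> 2 \<le> i \<Longrightarrow> \<eta> (m i) (m 1) = 0" for i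
    using N by (auto simp: mm null_dual_def)
  fix A B assume AB: "A < N" "B < N"
  show "\<eta> (?m A) (?m B) = (if A = null_dual B then 1 else 0)"
  proof (cases "A \<le> 1"; cases "B \<le> 1")
    assume "A \<le> 1" "B \<le> 1"
    then have "A = 0 \<or> A = 1" "B = 0 \<or> B = 1" by auto
    then show ?thesis using kk k1 m1 by (auto simp: null_dual_def)
  next
    assume "A \<le> 1" "\<not> B \<le> 1"
    then have "A = 0 \<or> A = 1" "2 \<le> B" by auto
    then show ?thesis using kw[of B] m1 AB by (auto simp: null_dual_def bilinear_simps[OF bil])
  next
    assume "\<not> A \<le> 1" "B \<le> 1"
    then have "B = 0 \<or> B = 1" "2 \<le> A" by auto
    then show ?thesis using kw[of A] m1 AB by (auto simp: null_dual_def bilinear_simps[OF bil])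
  next
    assume "\<not> A \<le> 1" "\<not> B \<le> 1"
    then show ?thesis using m1 AB mm[of A B]
      by (auto simp: null_dual_def bilinear_simps[OF bil])
  qed
qed

text \<open>The polynomial is the component 0j of \<open>K\<close> in the rotated frame, expanded;
  the cubic terms drop out because \<open>K (m 1) (m 1) = 0\<close>.\<close>

lemma alignment_poly_null_point:
  fixes K :: "'v::real_vector \<Rightarrow> 'v \<Rightarrow> real"
  assumes "bivector K"
  shows "alignment_poly N K m j z = K (null_point N m z) (m j - z j *\<^sub>R m 1)"
proof -
  have bil: "bilinear K" and skew: "K u v = - K v u" for u v
    using assms unfolding bivector_def by blast+
  have "K (m 1) (m 1) = 0" using skew[of "m 1" "m 1"] by simp
  then show ?thesis
    unfolding alignment_poly_def null_point_def
    by (simp add: bilinear_simps[OF bil] algebra_simps sum_distrib_left)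
qed

lemma sum_lessThan_split2:
  fixes f :: "nat \<Rightarrow> 'a::comm_monoid_add"
  assumes "N \<ge> 2"
  shows "(\<Sum>A<N. f A) = f 0 + f 1 + (\<Sum>i\<in>{2..<N}. f i)"
proof -
  have "{..<N} = insert 0 (insert 1 {2..<N})" using assms by auto
  then show ?thesis by (simp add: add.assoc)
qed

text \<open>The coefficient \<open>c 0\<close> decides. If it vanishes, nullity forces the sum of
  squares of the space-like coefficients to be 0; otherwise dividing by it gives \<open>z\<close>,
  and nullity determines the coefficient of \<open>m 1\<close>.\<close>

lemma null_vector_cases:
  fixes \<eta> :: "'v::real_vector \<Rightarrow> 'v \<Rightarrow> real"
  assumes bil: "bilinear \<eta>" and sym: "\<And>u v. \<eta> u v = \<eta> v u"
    and N: "N \<ge> 2" and m: "null_frame N \<eta> m"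
    and "k \<noteq> 0" "\<eta> k k = 0"
  obtains c where "c \<noteq> 0" "k = c *\<^sub>R m 1"
  | c z where "c \<noteq> 0" "z \<in> {2..<N} \<rightarrow>\<^sub>E UNIV" "k = c *\<^sub>R null_point N m z"
proof -
  obtain c where c: "k = (\<Sum>A<N. c A *\<^sub>R m A)"
    using m is_basis_expansion by (metis null_frame_def)
  have mm: "\<eta> (m A) (m B) = (if A = null_dual B then 1 else 0)" if "A < N" "B < N" for A B
    using m that by (simp add: null_frame_iff_dual)
  have km: "\<eta> k (m B) = c (null_dual B)" if "B < N" for B
  proof -
    have "\<eta> k (m B) = (\<Sum>A<N. if A = null_dual B then c A else 0)"
      unfolding c bilinear_lsum_scaleR[OF bil] using that by (intro sum.cong) (auto simp: mm)
    then show ?thesis using null_dual_less[OF N that] by simp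
  qed
  have "0 = (\<Sum>A<N. c A * \<eta> (m A) k)"
    using \<open>\<eta> k k = 0\<close> by (subst (asm) (2) c) (simp add: sym[of k] bilinear_lsum_scaleR[OF bil])
  also have "\<dots> = (\<Sum>A<N. c A * c (null_dual A))"
    by (intro sum.cong) (auto simp: km sym[of "m A" for A])
  also have "\<dots> = 2 * c 0 * c 1 + (\<Sum>i\<in>{2..<N}. c i * c i)"
    unfolding sum_lessThan_split2[OF N] by (simp add: null_dual_def)
  finally have q: "2 * c 0 * c 1 + (\<Sum>i\<in>{2..<N}. c i * c i) = 0" by simp
  show thesis
  proof (cases "c 0 = 0")
    case True
    with q have "c i = 0" if "i \<in> {2..<N}" for i
      using that by (simp add: sum_nonneg_eq_0_iff)
    with True have "k = c 1 *\<^sub>R m 1"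
      unfolding c sum_lessThan_split2[OF N] by simp
    moreover from this have "c 1 \<noteq> 0" using \<open>k \<noteq> 0\<close> by auto
    ultimately show ?thesis using that(1) by blast
  next
    case False
    define z where "z = restrict (\<lambda>i. c i / c 0) {2..<N}"
    have "(\<Sum>i\<in>{2..<N}. z i * z i) = (\<Sum>i\<in>{2..<N}. c i * c i) / (c 0 * c 0)"
      by (simp add: z_def sum_divide_distrib)
    also have "\<dots> = - 2 * c 1 / c 0" using q False by (simp add: field_simps)
    finally have "c 0 * (1/2 * (\<Sum>i\<in>{2..<N}. z i * z i)) = - c 1" using False by simp
    moreover have "(\<Sum>i\<in>{2..<N}. c i *\<^sub>R m i) = c 0 *\<^sub>R (\<Sum>i\<in>{2..<N}. z i *\<^sub>R m i)"
      using False by (simp add: z_def scaleR_sum_right)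
    ultimately have "k = c 0 *\<^sub>R null_point N m z"
      unfolding c sum_lessThan_split2[OF N] null_point_def
      by (simp add: scaleR_add_right scaleR_diff_right)
    moreover have "z \<in> {2..<N} \<rightarrow>\<^sub>E UNIV" by (simp add: z_def)
    ultimately show ?thesis using that(2) False by blast
  qed
qed

lemma lorentzian_null_frame_exists:
  fixes \<eta> :: "'v::real_vector \<Rightarrow> 'v \<Rightarrow> real"
  assumes "lorentzian N \<eta>" "N \<ge> 2"
  shows "\<exists>m :: nat \<Rightarrow> 'v. null_frame N \<eta> m"
proof -
  have bil: "bilinear \<eta>" using assms by (simp add: lorentzian_def)
  obtain e where basis: "is_basis N e"
    and e: "\<And>A B. A < N \<Longrightarrow> B < N \<Longrightarrow>
      \<eta> (e A) (e B) = (if A \<noteq> B then 0 else if A = 0 then - 1 else 1)"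
    using assms(1) unfolding lorentzian_def by blast
  \<comment> \<open>The product of \<open>e 1 + e 0\<close> and \<open>e 1 - e 0\<close> is 1 - (-1)
    = 2, whence the factor 1 / sqrt 2 on each.\<close>
  define m where "m A = (if A = 0 then (1 / sqrt 2) *\<^sub>R (e 1 + e 0)
    else if A = 1 then (1 / sqrt 2) *\<^sub>R (e 1 - e 0) else e A)" for A
  have "null_frame N \<eta> m"
  proof (rule null_frameI[OF bil assms(2) basis])
    fix A B assume "A < N" "B < N"
    then show "\<eta> (m A) (m B) = (if A = null_dual B then 1 else 0)"
      using assms(2) by (auto simp: m_def null_dual_def bilinear_simps[OF bil] e)
  qed
  then show ?thesis by blast
qed

lemma aligned_if_eigenvector:
  fixes \<eta> K :: "'v::real_vector \<Rightarrow> 'v \<Rightarrow> real"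
  assumes "bilinear \<eta>" "bilinear K" and m: "null_frame N \<eta> m"
    and eig: "\<And>v. K (m 0) v = l * \<eta> (m 0) v" and "m 0 \<in> span {k}"
  shows "aligned N \<eta> K k"
proof -
  have "\<eta> (m 0) (m i) = 0" if "i \<in> {2..<N}" for i
    using m that by (auto simp: null_frame_def)
  with assms show ?thesis unfolding aligned_def by auto
qed

subsection \<open>Null eigenvectors\<close>

text \<open>For k = e_0 + sum x_i e_(i+1), nullity means |x| = 1. The eigenvector equation tested on
  \<open>e 0\<close> gives l = E.x, and tested on the other \<open>e\<close> it is the sphere
  equation of \<open>odd_sphere_field_zero\<close>, in odd size N - 1.\<close>

lemma bivector_null_eigenvector:
  fixes \<eta> K :: "'v::real_vector \<Rightarrow> 'v \<Rightarrow> real"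
  assumes "N \<ge> 2" "even N" and lor: "lorentzian N \<eta>" and biv: "bivector K"
  shows "\<exists>k l. k \<noteq> 0 \<and> \<eta> k k = 0 \<and> (\<forall>v. K k v = l * \<eta> k v)"
proof -
  have bil: "bilinear \<eta>" and sym: "\<eta> u v = \<eta> v u" for u v
    using lor unfolding lorentzian_def by blast+
  have bilK: "bilinear K" and skew: "K u v = - K v u" for u v
    using biv unfolding bivector_def by blast+
  obtain e where basis: "is_basis N e"
    and e: "\<And>A B. A < N \<Longrightarrow> B < N \<Longrightarrow>
      \<eta> (e A) (e B) = (if A \<noteq> B then 0 else if A = 0 then - 1 else 1)"
    using lor unfolding lorentzian_def by blast
  define n where "n = N - 1"
  have N: "N = Suc n" and "odd n" using assms(1,2) by (auto simp: n_def)
  define E where "E i = K (e 0) (e (Suc i))" for i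
  \<comment> \<open>The indices are transposed so that row \<open>j\<close> of \<open>B\<close>
    applied to \<open>x\<close> is \<open>K\<close> of the space-like part of \<open>k\<close> with
    \<open>e (Suc j)\<close>.\<close>
  define B where "B i j = K (e (Suc j)) (e (Suc i))" for i j
  have "\<forall>i j. B i j = - B j i" unfolding B_def using skew by blast
  from odd_sphere_field_zero[OF \<open>odd n\<close> this, of E] obtain x
    where x1: "(\<Sum>i<n. (x i)\<^sup>2) = 1"
      and x: "\<And>j. j < n \<Longrightarrow> E j + (\<Sum>i<n. B j i * x i) = (\<Sum>i<n. E i * x i) * x j"
    by blast
  define l where "l = (\<Sum>i<n. E i * x i)"
  define k where "k = e 0 + (\<Sum>i<n. x i *\<^sub>R e (Suc i))"
  have h_k: "h k v = h (e 0) v + (\<Sum>i<n. x i * h (e (Suc i)) v)"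
    if "bilinear h" for h :: "'v \<Rightarrow> 'v \<Rightarrow> real" and v
    unfolding k_def by (simp add: bilinear_simps[OF that])
  have k0: "\<eta> k (e 0) = - 1"
    by (simp add: h_k[OF bil] e N)
  have kS: "\<eta> k (e (Suc j)) = x j" if "j < n" for j
  proof -
    have "(\<Sum>i<n. x i * \<eta> (e (Suc i)) (e (Suc j))) = (\<Sum>i<n. if i = j then x i else 0)"
      using that by (intro sum.cong) (auto simp: e N)
    then show ?thesis using that by (simp add: h_k[OF bil] e N)
  qed
  have "\<eta> k k = \<eta> (e 0) k + (\<Sum>i<n. x i * \<eta> (e (Suc i)) k)"
    by (rule h_k[OF bil])
  also have "(\<Sum>i<n. x i * \<eta> (e (Suc i)) k) = (\<Sum>i<n. (x i)\<^sup>2)"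
    by (intro sum.cong refl) (simp add: sym[of "e A" k for A] kS power2_eq_square)
  finally have "\<eta> k k = 0" by (simp add: sym[of "e A" k for A] k0 x1)
  moreover have "k \<noteq> 0" using k0 bilinear_lzero[OF bil, of "e 0"] by auto
  moreover have "K k v = l * \<eta> k v" for v
  proof -
    have "K (e 0) (e 0) = 0" using skew[of "e 0" "e 0"] by simp
    moreover have "x i * K (e (Suc i)) (e 0) = - (E i * x i)" for i
      unfolding E_def by (subst skew) simp
    ultimately have K0: "K k (e 0) = l * \<eta> k (e 0)"
      by (simp add: h_k[OF bilK] k0 l_def sum_negf)
    have KS: "K k (e (Suc j)) = l * \<eta> k (e (Suc j))" if "j < n" for j
      using x[OF that] that by (simp add: h_k[OF bilK] kS l_def E_def B_def mult.commute)
    have Ke: "K k (e A) = l * \<eta> k (e A)" if "A < N" for A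
      using that K0 KS by (cases A) (auto simp: N)
    obtain c where c: "v = (\<Sum>A<N. c A *\<^sub>R e A)"
      using is_basis_expansion[OF basis] by blast
    \<comment> \<open>The expansion lemma is linear in the first slot, so the computation runs on
      \<open>K v k\<close> and skewness turns it round at both ends.\<close>
    have "K v k = (\<Sum>A<N. c A * K (e A) k)"
      unfolding c by (rule bilinear_lsum_scaleR[OF bilK])
    also have "\<dots> = (\<Sum>A<N. c A * (- l * \<eta> (e A) k))"
      by (intro sum.cong refl) (subst skew, simp add: Ke sym[of "e A" k for A])
    also have "\<dots> = - l * \<eta> v k"
      unfolding c bilinear_lsum_scaleR[OF bil] by (simp add: sum_distrib_left mult_ac)
    finally show ?thesis by (subst skew) (simp add: sym[of v k])
  qed
  ultimately show ?thesis by blast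
qed

theorem proposition4p4:
  fixes N :: nat
    and \<eta> K :: "'v::real_vector \<Rightarrow> 'v \<Rightarrow> real"
  assumes "N \<ge> 2" and "even N"
    and "dim (UNIV :: 'v set) = N"
    and "lorentzian N \<eta>"
    and "bivector K"
  shows "(\<forall>m. null_frame N \<eta> m \<longrightarrow> (\<exists>p\<in>extended_space N. alignment_zero N \<eta> K m p))
       \<and> (\<exists>k. k \<noteq> 0 \<and> null_vector \<eta> k \<and> aligned N \<eta> K k)"
proof -
  have bil: "bilinear \<eta>" and sym: "\<And>u v. \<eta> u v = \<eta> v u"
    using assms(4) unfolding lorentzian_def by blast+
  have bilK: "bilinear K" using assms(5) unfolding bivector_def by blast
  obtain k l where k: "k \<noteq> 0" "\<eta> k k = 0" and eig: "\<And>v. K k v = l * \<eta> k v"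
    using bivector_null_eigenvector[OF assms(1,2,4,5)] by blast
  have eig_scale: "K u v = l * \<eta> u v" if "c \<noteq> 0" "k = c *\<^sub>R u" for c u v
    using eig[of v] that by (simp add: bilinear_simps[OF bil] bilinear_simps[OF bilK])
  have in_span: "u \<in> span {k}" if "c \<noteq> 0" "k = c *\<^sub>R u" for c u
  proof -
    have "u = (1 / c) *\<^sub>R k" using that by simp
    then show ?thesis by (metis span_base span_scale singletonI)
  qed
  \<comment> \<open>One eigenvector \<open>k\<close> serves every frame: it is either a multiple of
    \<open>m 1\<close>, giving \<open>Infinity\<close>, or a multiple of a null point, giving
    \<open>Finite z\<close>.\<close>
  have zero: "\<exists>p\<in>extended_space N. alignment_zero N \<eta> K m p" if m: "null_frame N \<eta> m" for m
  proof (rule null_vector_cases[OF bil sym assms(1) m k])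
    fix c assume c: "c \<noteq> 0" "k = c *\<^sub>R m 1"
    have "aligned N \<eta> K (m 1)"
      using null_frame_swap[OF bil assms(1) m] eig_scale[OF c]
      by (intro aligned_if_eigenvector[OF bil bilK, where l = l and m = "\<lambda>A. m (null_dual A)"]) (simp_all add: null_dual_def span_base)
    then show ?thesis by (intro bexI[of _ Infinity]) (auto simp: extended_space_def)
  next
    fix c z assume c: "c \<noteq> 0" "z \<in> {2..<N} \<rightarrow>\<^sub>E UNIV" "k = c *\<^sub>R null_point N m z"
    \<comment> \<open>By the eigenvector relation the polynomial is \<open>l\<close> times the
      product of the null point with \<open>m j - z j *\<^sub>R m 1\<close>, which is z j - z j =
      0.\<close>
    have "alignment_poly N K m j z = 0" if j: "j \<in> {2..<N}" for j
      unfolding alignment_poly_null_point[OF assms(5)] eig_scale[OF c(1,3)]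
      using null_point_products(2,3)[OF bil assms(1) m, where z = z] j
      by (simp add: bilinear_simps[OF bil])
    with c(2) show ?thesis
      by (intro bexI[of _ "Finite z"]) (auto simp: extended_space_def)
  qed
  obtain m where m: "null_frame N \<eta> m"
    using lorentzian_null_frame_exists[OF assms(4,1)] by blast
  \<comment> \<open>A frame with vector 0 along \<open>k\<close> is needed: the swapped frame if
    \<open>k\<close> lies along \<open>m 1\<close>, the rotated one otherwise.\<close>
  have "aligned N \<eta> K k"
  proof (rule null_vector_cases[OF bil sym assms(1) m k])
    fix c assume c: "c \<noteq> 0" "k = c *\<^sub>R m 1"
    show ?thesis
      using null_frame_swap[OF bil assms(1) m] eig_scale[OF c] in_span[OF c]
      by (intro aligned_if_eigenvector[OF bil bilK, where l = l and m = "\<lambda>A. m (null_dual A)"]) (simp_all add: null_dual_def)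
  next
    fix c z assume c: "c \<noteq> 0" "k = c *\<^sub>R null_point N m z"
    show ?thesis
      using eig_scale[OF c] in_span[OF c]
      by (intro aligned_if_eigenvector[OF bil bilK null_frame_rotate[OF bil sym assms(1) m, where z = z],
            where l = l]) simp_all
  qed
  with zero k show ?thesis by (auto simp: null_vector_def)
qed

end
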